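(* Let $G$ and $H$ be two strongly connected digraphs, each with at least two vertices. Then $$\lambda_2(G\Box H)\le \min\{\lambda(G)\,|V(H)|,\ \lambda(H)\,|V(G)|,\ \delta^+(G)+\delta^+(H),\ \delta^-(G)+\delta^-(H)\}.$$ Moreover, this bound is sharp (there exist such $G,H$ for which equality holds).
   Context: All digraphs are finite, without loops or parallel arcs. For a digraph $D$, $\lambda(D)$ is its arc-strong connectivity, and $\delta^+(D)$, $\delta^-(D)$ are its minimum out-degree and in-degree. For a digraph $D$ and $S\subseteq V(D)$, an $S$-strong subgraph is a strongly connected subgraph of $D$ containing all vertices of $S$; $\lambda_S(D)$ is the maximum number of pairwise arc-disjoint $S$-strong subgraphs of $D$; and for $2\le k\le |V(D)|$, the strong subgraph $k$-arc-connectivity is $\lambda_k(D)=\min\{\lambda_S(D): S\subseteq V(D),\ |S|=k\}$. The Cartesian product $G\Box H$ has vertex set $V(G)\times V(H)$, and $(x,x')(y,y')$ is an arc iff either $xy\in A(G)$ and $x'=y'$, or $x=y$ and $x'y'\in A(H)$. *)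

theory Defs
  imports "Graph_Theory.Graph_Theory"
begin

definition min_out_degree :: "('a,'b) pre_digraph \<Rightarrow> nat" where
  "min_out_degree D = Min (out_degree D ` verts D)"

definition min_in_degree :: "('a,'b) pre_digraph \<Rightarrow> nat" where
  "min_in_degree D = Min (in_degree D ` verts D)"

definition del_arcs :: "('a,'b) pre_digraph \<Rightarrow> 'b set \<Rightarrow> ('a,'b) pre_digraph" where
  "del_arcs D W = D\<lparr>arcs := arcs D - W\<rparr>"

definition arc_strong :: "nat \<Rightarrow> ('a,'b) pre_digraph \<Rightarrow> bool" where
  "arc_strong k D \<longleftrightarrow> (\<forall>W \<subseteq> arcs D. card W < k \<longrightarrow> strongly_connected (del_arcs D W))"

text \<open>
  Every digraph is 0-arc-strong. If \<open>D\<close> is finite with at least two vertices, then it is not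
  \<open>k\<close>-arc-strong for \<open>k\<close> larger than its number of arcs, so the maximum is over a
  nonempty finite set. On a single vertex the value is meaningless.
\<close>
definition arc_strong_connectivity :: "('a,'b) pre_digraph \<Rightarrow> nat" where
  "arc_strong_connectivity D = Max {k. arc_strong k D}"

definition strong_subgraph_on :: "'a set \<Rightarrow> ('a,'b) pre_digraph \<Rightarrow> ('a,'b) pre_digraph \<Rightarrow> bool" where
  "strong_subgraph_on S D K \<longleftrightarrow> subgraph K D \<and> strongly_connected K \<and> S \<subseteq> verts K"

text \<open>
  Families of subgraphs are represented by sets. For \<open>card S \<ge> 2\<close> this loses nothing: an
  \<open>S\<close>-strong subgraph then has an arc, so arc-disjoint members of a family are distinct.
\<close>
definition lambda_set :: "'a set \<Rightarrow> ('a,'b) pre_digraph \<Rightarrow> nat" where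
  "lambda_set S D = Max {card F | F. (\<forall>K \<in> F. strong_subgraph_on S D K) \<and>
     pairwise (\<lambda>K L. arcs K \<inter> arcs L = {}) F}"

definition strong_subgraph_arc_connectivity :: "nat \<Rightarrow> ('a,'b) pre_digraph \<Rightarrow> nat" where
  "strong_subgraph_arc_connectivity k D = Min {lambda_set S D | S. S \<subseteq> verts D \<and> card S = k}"

definition cartesian_product ::
  "'a pair_pre_digraph \<Rightarrow> 'b pair_pre_digraph \<Rightarrow> ('a \<times> 'b) pair_pre_digraph" (infixl \<open>\<box>\<close> 70) where
  "G \<box> H = \<lparr> pverts = pverts G \<times> pverts H,
     parcs = {((x, x'), (y, y')) | x x' y y'.
       (x, y) \<in> parcs G \<and> x' = y' \<and> x' \<in> pverts H \<or>
       x = y \<and> x \<in> pverts G \<and> (x', y') \<in> parcs H} \<rparr>"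

definition product_bound :: "'a pair_pre_digraph \<Rightarrow> 'b pair_pre_digraph \<Rightarrow> nat" where
  "product_bound G H = Min {
     arc_strong_connectivity (with_proj G) * card (pverts H),
     arc_strong_connectivity (with_proj H) * card (pverts G),
     min_out_degree (with_proj G) + min_out_degree (with_proj H),
     min_in_degree (with_proj G) + min_in_degree (with_proj H)}"

end

theory Submission
  imports Defs
begin

text \<open>
  If a vertex set \<open>U\<close> separates \<open>s\<close> from \<open>t\<close>, every strong subgraph containing both has an arc
  leaving \<open>U\<close>, so \<open>\<lambda>\<^sub>2\<close> is at most the number of arcs leaving \<open>U\<close>. Each of the four
  bounds is such a cut of the product: a minimum cut of one factor times the other factor, a single
  vertex, or the complement of a single vertex. Equality holds for two copies of the complete digraph
  on two vertices: their product is the bidirected 4-cycle, whose two orientations are arc-disjoint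
  Hamiltonian cycles.
\<close>

section \<open>Cuts and reachability\<close>

text \<open>The set \<open>U\<close> need not lie inside \<open>verts D\<close>, so complements such
  as \<open>- {p}\<close> are also allowed.\<close>

definition out_cut :: "('a,'b) pre_digraph \<Rightarrow> 'a set \<Rightarrow> 'b set" where
  "out_cut D U = {a \<in> arcs D. tail D a \<in> U \<and> head D a \<notin> U}"

lemma finite_out_cut: "finite (arcs D) \<Longrightarrow> finite (out_cut D U)"
  by (simp add: out_cut_def)

text \<open>With no arc leaving it, \<open>U\<close> would be closed under following arcs, so
  induction along a walk from \<open>u\<close> would never leave \<open>U\<close>.\<close>

lemma reachable_out_cut_nonempty:
  assumes "u \<rightarrow>\<^sup>*\<^bsub>D\<^esub> v" "u \<in> U" "v \<notin> U"
  shows "out_cut D U \<noteq> {}"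
proof
  assume empty: "out_cut D U = {}"
  have "(u, v) \<in> rtrancl_on (verts D) (arcs_ends D)"
    using assms(1) by (simp add: reachable_def)
  then have "v \<in> U"
    using assms(2) by induction (use empty in \<open>auto simp: out_cut_def arcs_ends_conv\<close>)
  with assms(3) show False by simp
qed

section \<open>Finiteness of subgraph families and bounds on \<open>lambda_set\<close>\<close>

text \<open>Compatibility forces the tail and head functions of \<open>D\<close> on every subgraph,
  which is therefore determined by its vertex set and arc set. This finiteness gives the
  \<open>Max\<close> in \<open>lambda_set\<close> its meaning.\<close>

lemma finite_subgraphs:
  assumes "fin_digraph D"
  shows "finite {K. subgraph K D}"
proof -
  interpret fin_digraph D by fact
  have "{K. subgraph K D} \<subseteq>
      (\<lambda>(V, A). \<lparr>verts = V, arcs = A, tail = tail D, head = head D\<rparr>) `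
        (Pow (verts D) \<times> Pow (arcs D))"
  proof
    fix K assume "K \<in> {K. subgraph K D}"
    then have "K = \<lparr>verts = verts K, arcs = arcs K, tail = tail D, head = head D\<rparr>"
      and "verts K \<subseteq> verts D" "arcs K \<subseteq> arcs D"
      by (auto simp: subgraph_def compatible_def)
    then show "K \<in> (\<lambda>(V, A). \<lparr>verts = V, arcs = A, tail = tail D, head = head D\<rparr>) `
        (Pow (verts D) \<times> Pow (arcs D))"
      by (metis (mono_tags, lifting) PowI SigmaI case_prod_conv image_eqI)
  qed
  then show ?thesis
    by (rule finite_subset) simp
qed

lemma finite_strong_subgraph_families:
  assumes "fin_digraph D"
  shows "finite {F. \<forall>K \<in> F. strong_subgraph_on S D K}"
proof (rule finite_subset)
  show "{F. \<forall>K \<in> F. strong_subgraph_on S D K} \<subseteq> Pow {K. subgraph K D}"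
    by (auto simp: strong_subgraph_on_def)
  show "finite (Pow {K. subgraph K D})"
    using finite_subgraphs[OF assms] by simp
qed

lemma finite_lambda_set_values:
  assumes "fin_digraph D"
  shows "finite {card F | F. (\<forall>K \<in> F. strong_subgraph_on S D K) \<and>
     pairwise (\<lambda>K L. arcs K \<inter> arcs L = {}) F}"
proof -
  have "finite (card ` {F. \<forall>K \<in> F. strong_subgraph_on S D K})"
    using finite_strong_subgraph_families[OF assms] by simp
  then show ?thesis
    by (rule rev_finite_subset) auto
qed

lemma lambda_set_leI:
  assumes "fin_digraph D"
    and "\<And>F. \<lbrakk>\<And>K. K \<in> F \<Longrightarrow> strong_subgraph_on S D K;
      pairwise (\<lambda>K L. arcs K \<inter> arcs L = {}) F\<rbrakk> \<Longrightarrow> card F \<le> n"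
  shows "lambda_set S D \<le> n"
  unfolding lambda_set_def
proof (rule Max.boundedI[OF finite_lambda_set_values[OF assms(1)]])
  show "{card F | F. (\<forall>K \<in> F. strong_subgraph_on S D K) \<and>
     pairwise (\<lambda>K L. arcs K \<inter> arcs L = {}) F} \<noteq> {}"
    \<comment> \<open>The empty family satisfies both conditions, so 0 is always among the
      values.\<close>
    by (auto intro!: exI[of _ "{}"])
qed (use assms(2) in auto)

lemma lambda_set_geI:
  assumes "fin_digraph D"
    and "\<And>K. K \<in> F \<Longrightarrow> strong_subgraph_on S D K"
    and "pairwise (\<lambda>K L. arcs K \<inter> arcs L = {}) F"
  shows "card F \<le> lambda_set S D"
  unfolding lambda_set_def
  by (rule Max_ge[OF finite_lambda_set_values[OF assms(1)]]) (use assms in blast)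

lemma lambda_set_le_out_cut:
  assumes fin: "fin_digraph D" and "s \<in> S" "t \<in> S" "s \<in> U" "t \<notin> U"
  shows "lambda_set S D \<le> card (out_cut D U)"
proof (rule lambda_set_leI[OF fin])
  fix F
  assume F: "\<And>K. K \<in> F \<Longrightarrow> strong_subgraph_on S D K"
    and disj: "pairwise (\<lambda>K L. arcs K \<inter> arcs L = {}) F"
  have "\<exists>a. a \<in> arcs K \<inter> out_cut D U" if "K \<in> F" for K
  proof -
    have K: "subgraph K D" "strongly_connected K" "S \<subseteq> verts K"
      using F[OF that] by (auto simp: strong_subgraph_on_def)
    then have "s \<rightarrow>\<^sup>*\<^bsub>K\<^esub> t"
      using assms(2,3) by (auto simp: strongly_connected_def)
    \<comment> \<open>The arc of \<open>K\<close> leaving \<open>U\<close> has the same ends in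
      \<open>D\<close>, by compatibility.\<close>
    from reachable_out_cut_nonempty[OF this assms(4,5)] K(1) show ?thesis
      by (auto simp: out_cut_def subgraph_def compatible_def)
  qed
  then obtain f where f: "\<And>K. K \<in> F \<Longrightarrow> f K \<in> arcs K \<inter> out_cut D U"
    by metis
  \<comment> \<open>Two members with the same chosen arc would share that arc, so disjointness makes
    them equal.\<close>
  have "inj_on f F"
    using f disj by (fastforce simp: inj_on_def pairwise_def)
  moreover have "f ` F \<subseteq> out_cut D U"
    using f by auto
  moreover have "finite (out_cut D U)"
    using fin by (simp add: finite_out_cut fin_digraph.finite_arcs)
  ultimately show "card F \<le> card (out_cut D U)"
    by (metis card_image card_mono)
qed

section \<open>Bounds on the strong subgraph arc-connectivity\<close>

lemma finite_strong_subgraph_arc_connectivity_values: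
  assumes "fin_digraph D"
  shows "finite {lambda_set S D | S. S \<subseteq> verts D \<and> card S = k}"
proof -
  have "finite ((\<lambda>S. lambda_set S D) ` Pow (verts D))"
    using assms by (simp add: fin_digraph.finite_verts)
  then show ?thesis
    by (rule rev_finite_subset) auto
qed

text \<open>The pair \<open>{s, t}\<close> is one candidate in the minimum. Hence each upper bound
  below only has to name a cut and one vertex on either side of it.\<close>

lemma strong_subgraph_arc_connectivity_2_le_out_cut:
  assumes fin: "fin_digraph D" and "s \<in> verts D" "t \<in> verts D" "s \<in> U" "t \<notin> U"
  shows "strong_subgraph_arc_connectivity 2 D \<le> card (out_cut D U)"
proof -
  have "s \<noteq> t"
    using assms by auto
  then have "{s, t} \<subseteq> verts D \<and> card {s, t} = 2"
    using assms by simp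
  then have "strong_subgraph_arc_connectivity 2 D \<le> lambda_set {s, t} D"
    unfolding strong_subgraph_arc_connectivity_def
    by (intro Min_le[OF finite_strong_subgraph_arc_connectivity_values[OF fin]]) blast
  also have "\<dots> \<le> card (out_cut D U)"
    by (rule lambda_set_le_out_cut[OF fin]) (use assms in auto)
  finally show ?thesis .
qed

lemma strong_subgraph_arc_connectivity_geI:
  assumes fin: "fin_digraph D" and "k \<le> card (verts D)"
    and "\<And>S. \<lbrakk>S \<subseteq> verts D; card S = k\<rbrakk> \<Longrightarrow> n \<le> lambda_set S D"
  shows "n \<le> strong_subgraph_arc_connectivity k D"
  unfolding strong_subgraph_arc_connectivity_def
proof (rule Min.boundedI[OF finite_strong_subgraph_arc_connectivity_values[OF fin]])
  \<comment> \<open>The bound on \<open>k\<close> provides a set of size \<open>k\<close>, so the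
    minimum is over a nonempty set.\<close>
  obtain S where "S \<subseteq> verts D" "card S = k"
    using obtain_subset_with_card_n[OF assms(2)] by metis
  then show "{lambda_set S D | S. S \<subseteq> verts D \<and> card S = k} \<noteq> {}"
    by blast
qed (use assms(3) in auto)

section \<open>Arc-strong connectivity and cuts\<close>

text \<open>Deleting all arcs isolates the vertices, and with two of them strong connectivity fails.
  So no \<open>k\<close> above the number of arcs qualifies, and \<open>Max\<close> is over a finite
  set.\<close>

lemma finite_arc_strong:
  assumes "finite (arcs D)" "card (verts D) \<ge> 2"
  shows "finite {k. arc_strong k D}"
proof (rule finite_subset)
  show "{k. arc_strong k D} \<subseteq> {..card (arcs D)}"
  proof (intro subsetI, rule ccontr)
    fix k assume "k \<in> {k. arc_strong k D}" "k \<notin> {..card (arcs D)}"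
    then have sc: "strongly_connected (del_arcs D (arcs D))"
      by (auto simp: arc_strong_def)
    obtain u v where "u \<in> verts D" "v \<in> verts D" "u \<noteq> v"
      using assms(2) by (metis card_2_iff' obtain_subset_with_card_n subset_iff)
    then have "u \<rightarrow>\<^sup>*\<^bsub>del_arcs D (arcs D)\<^esub> v"
      using sc by (auto simp: strongly_connected_def del_arcs_def)
    from reachable_out_cut_nonempty[OF this, of "{u}"] \<open>u \<noteq> v\<close> show False
      by (auto simp: out_cut_def del_arcs_def)
  qed
qed simp

text \<open>By maximality, some set \<open>W\<close> of at most
  \<open>arc_strong_connectivity D\<close> arcs destroys strong connectivity. The vertices still
  reachable from a suitable \<open>u\<close> form \<open>U\<close>; an arc outside \<open>W\<close>
  leaving \<open>U\<close> would extend a walk, so the whole cut lies in \<open>W\<close>.\<close>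

lemma arc_strong_connectivity_out_cut:
  assumes fin: "fin_digraph D" and "card (verts D) \<ge> 2"
  obtains U u v where "u \<in> verts D" "v \<in> verts D" "u \<in> U" "v \<notin> U"
    "card (out_cut D U) \<le> arc_strong_connectivity D"
proof -
  interpret fin_digraph D by fact
  let ?k = "arc_strong_connectivity D"
  have "\<not> arc_strong (Suc ?k) D"
    using Max_ge[OF finite_arc_strong[OF finite_arcs assms(2)], of "Suc ?k"]
    unfolding arc_strong_connectivity_def by auto
  then obtain W where W: "W \<subseteq> arcs D" "card W \<le> ?k" "\<not> strongly_connected (del_arcs D W)"
    by (auto simp: arc_strong_def less_Suc_eq_le)
  \<comment> \<open>Strong connectivity also demands a vertex; this leaves an unreachable pair as
    the only way for it to fail.\<close>
  have "verts D \<noteq> {}"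
    using assms(2) by auto
  then obtain u v where uv: "u \<in> verts D" "v \<in> verts D" "\<not> u \<rightarrow>\<^sup>*\<^bsub>del_arcs D W\<^esub> v"
    using W(3) by (auto simp: strongly_connected_def del_arcs_def)
  define U where "U = {x. u \<rightarrow>\<^sup>*\<^bsub>del_arcs D W\<^esub> x}"
  have "out_cut D U \<subseteq> W"
  proof (rule ccontr)
    assume "\<not> ?thesis"
    then obtain a where a: "a \<in> arcs D" "a \<notin> W" "tail D a \<in> U" "head D a \<notin> U"
      by (auto simp: out_cut_def)
    then have "(tail D a, head D a) \<in> arcs_ends (del_arcs D W)" "head D a \<in> verts (del_arcs D W)"
      by (auto simp: arcs_ends_conv del_arcs_def)
    with a(3) have "head D a \<in> U"
      unfolding U_def reachable_def by (auto intro: rtrancl_on_into_rtrancl_on)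
    with a(4) show False by simp
  qed
  then have "card (out_cut D U) \<le> ?k"
    using W card_mono[of W "out_cut D U"] finite_subset[OF W(1)] by fastforce
  moreover have "u \<in> U" "v \<notin> U"
    using uv by (auto simp: U_def reachable_def del_arcs_def)
  ultimately show thesis
    using that uv by blast
qed

section \<open>The Cartesian product as a finite digraph\<close>

lemma pverts_cartesian_product [simp]: "pverts (G \<box> H) = pverts G \<times> pverts H"
  by (simp add: cartesian_product_def)

text \<open>Exhibits the arcs as images of finite products: copies of \<open>G\<close>-arcs in
  layers indexed by \<open>H\<close>, and conversely. Finiteness of the product follows from this
  form.\<close>

lemma parcs_cartesian_product:
  "parcs (G \<box> H) =
    (\<lambda>((x, y), z). ((x, z), (y, z))) ` (parcs G \<times> pverts H) \<union>
    (\<lambda>(z, (x, y)). ((z, x), (z, y))) ` (pverts G \<times> parcs H)"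
  by (force simp: cartesian_product_def)

lemma pair_fin_digraph_imp_fin_digraph: "pair_fin_digraph G \<Longrightarrow> fin_digraph (with_proj G)"
  by (auto simp: pair_fin_digraph_def pair_fin_digraph_axioms_def pair_wf_digraph_def
      fin_digraph_def fin_digraph_axioms_def wf_digraph_def)

lemma pair_fin_digraph_cartesian_product:
  assumes "pair_fin_digraph G" "pair_fin_digraph H"
  shows "pair_fin_digraph (G \<box> H)"
proof -
  interpret G: pair_fin_digraph G by fact
  interpret H: pair_fin_digraph H by fact
  show ?thesis
    by unfold_locales
      (auto simp: parcs_cartesian_product G.pair_finite_verts H.pair_finite_verts
        G.pair_finite_arcs H.pair_finite_arcs dest: G.wellformed' H.wellformed')
qed

section \<open>The four upper bounds\<close>

context
  fixes G :: "'a pair_pre_digraph" and H :: "'b pair_pre_digraph"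
  assumes G: "pair_fin_digraph G" and H: "pair_fin_digraph H"
    and card_G: "card (pverts G) \<ge> 2" and card_H: "card (pverts H) \<ge> 2"
begin

interpretation G: pair_fin_digraph G by (rule G)
interpretation H: pair_fin_digraph H by (rule H)

lemma fin_digraph_cartesian_product: "fin_digraph (with_proj (G \<box> H))"
  by (intro pair_fin_digraph_imp_fin_digraph pair_fin_digraph_cartesian_product G H)

lemma pverts_nonempty: "pverts G \<noteq> {}" "pverts H \<noteq> {}"
  using card_G card_H by auto

text \<open>Supplies the vertex on the far side of a single-vertex cut.\<close>

lemma other_vertex: obtains q where "q \<in> pverts G \<times> pverts H" "q \<noteq> p"
proof -
  obtain x y where "x \<in> pverts G" "y \<in> pverts G" "x \<noteq> y"
    using card_G by (metis card_2_iff' obtain_subset_with_card_n subset_iff)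
  moreover obtain z where "z \<in> pverts H"
    using pverts_nonempty by auto
  ultimately show thesis
    using that[of "(x, z)"] that[of "(y, z)"] by (cases p) auto
qed

text \<open>The cut is \<open>U \<times> pverts H\<close> for a small cut \<open>U\<close> of
  \<open>G\<close>. It contains one copy of the cut of \<open>G\<close> for each vertex of
  \<open>H\<close>.\<close>

lemma product_connectivity_le_arc_strong_left:
  "strong_subgraph_arc_connectivity 2 (with_proj (G \<box> H)) \<le>
    arc_strong_connectivity (with_proj G) * card (pverts H)"
proof -
  obtain U u v where U: "u \<in> pverts G" "v \<in> pverts G" "u \<in> U" "v \<notin> U"
    "card (out_cut (with_proj G) U) \<le> arc_strong_connectivity (with_proj G)"
    using arc_strong_connectivity_out_cut[OF pair_fin_digraph_imp_fin_digraph[OF G],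
        unfolded with_proj_simps, OF card_G]
    by blast
  obtain z where "z \<in> pverts H"
    using pverts_nonempty by auto
  then have "strong_subgraph_arc_connectivity 2 (with_proj (G \<box> H)) \<le>
      card (out_cut (with_proj (G \<box> H)) (U \<times> pverts H))"
    using U
    by (intro strong_subgraph_arc_connectivity_2_le_out_cut[OF fin_digraph_cartesian_product,
          of "(u, z)" "(v, z)"]) auto
  also have "\<dots> \<le> card (out_cut (with_proj G) U \<times> pverts H)"
  proof (rule surj_card_le)
    show "finite (out_cut (with_proj G) U \<times> pverts H)"
      by (simp add: finite_out_cut G.pair_finite_arcs H.pair_finite_verts)
    show "out_cut (with_proj (G \<box> H)) (U \<times> pverts H) \<subseteq>
        (\<lambda>((x, y), z). ((x, z), (y, z))) ` (out_cut (with_proj G) U \<times> pverts H)"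
      \<comment> \<open>An arc coming from \<open>H\<close> keeps its first coordinate and ends in
        \<open>pverts H\<close>, so it cannot leave \<open>U \<times> pverts H\<close>.\<close>
      by (force simp: out_cut_def cartesian_product_def dest: H.wellformed')
  qed
  also have "\<dots> \<le> arc_strong_connectivity (with_proj G) * card (pverts H)"
    using U(5) by (simp add: card_cartesian_product)
  finally show ?thesis .
qed

lemma product_connectivity_le_arc_strong_right:
  "strong_subgraph_arc_connectivity 2 (with_proj (G \<box> H)) \<le>
    arc_strong_connectivity (with_proj H) * card (pverts G)"
proof -
  obtain U u v where U: "u \<in> pverts H" "v \<in> pverts H" "u \<in> U" "v \<notin> U"
    "card (out_cut (with_proj H) U) \<le> arc_strong_connectivity (with_proj H)"
    using arc_strong_connectivity_out_cut[OF pair_fin_digraph_imp_fin_digraph[OF H],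
        unfolded with_proj_simps, OF card_H]
    by blast
  obtain z where "z \<in> pverts G"
    using pverts_nonempty by auto
  then have "strong_subgraph_arc_connectivity 2 (with_proj (G \<box> H)) \<le>
      card (out_cut (with_proj (G \<box> H)) (pverts G \<times> U))"
    using U
    by (intro strong_subgraph_arc_connectivity_2_le_out_cut[OF fin_digraph_cartesian_product,
          of "(z, u)" "(z, v)"]) auto
  also have "\<dots> \<le> card (out_cut (with_proj H) U \<times> pverts G)"
  proof (rule surj_card_le)
    show "finite (out_cut (with_proj H) U \<times> pverts G)"
      by (simp add: finite_out_cut H.pair_finite_arcs G.pair_finite_verts)
    show "out_cut (with_proj (G \<box> H)) (pverts G \<times> U) \<subseteq>
        (\<lambda>((x, y), z). ((z, x), (z, y))) ` (out_cut (with_proj H) U \<times> pverts G)"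
      by (force simp: out_cut_def cartesian_product_def dest: G.wellformed')
  qed
  also have "\<dots> \<le> arc_strong_connectivity (with_proj H) * card (pverts G)"
    using U(5) by (simp add: card_cartesian_product)
  finally show ?thesis .
qed

text \<open>The cut is the single vertex \<open>(x, y)\<close>: an arc leaving it copies an out-arc
  of \<open>x\<close> or of \<open>y\<close>. As \<open>x\<close> and \<open>y\<close> are
  independent, both degrees can be minimised at once.\<close>

lemma product_connectivity_le_out_degree:
  assumes "x \<in> pverts G" "y \<in> pverts H"
  shows "strong_subgraph_arc_connectivity 2 (with_proj (G \<box> H)) \<le>
    out_degree (with_proj G) x + out_degree (with_proj H) y"
proof -
  obtain q where q: "q \<in> pverts G \<times> pverts H" "q \<noteq> (x, y)"
    by (rule other_vertex)
  let ?A = "(\<lambda>(u, v). ((u, y), (v, y))) ` out_arcs (with_proj G) x"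
  let ?B = "(\<lambda>(u, v). ((x, u), (x, v))) ` out_arcs (with_proj H) y"
  have fin: "finite (out_arcs (with_proj G) x)" "finite (out_arcs (with_proj H) y)"
    by (simp_all add: out_arcs_def G.pair_finite_arcs H.pair_finite_arcs)
  have "strong_subgraph_arc_connectivity 2 (with_proj (G \<box> H)) \<le>
      card (out_cut (with_proj (G \<box> H)) {(x, y)})"
    using assms q
    by (intro strong_subgraph_arc_connectivity_2_le_out_cut[OF fin_digraph_cartesian_product,
          of "(x, y)" q]) auto
  also have "\<dots> \<le> card (?A \<union> ?B)"
  proof (rule card_mono)
    show "finite (?A \<union> ?B)"
      using fin by simp
    show "out_cut (with_proj (G \<box> H)) {(x, y)} \<subseteq> ?A \<union> ?B"
      by (force simp: out_cut_def out_arcs_def cartesian_product_def)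
  qed
  also have "\<dots> \<le> card ?A + card ?B"
    by (rule card_Un_le)
  also have "\<dots> \<le> out_degree (with_proj G) x + out_degree (with_proj H) y"
    unfolding out_degree_def by (intro add_mono card_image_le fin)
  finally show ?thesis .
qed

lemma product_connectivity_le_in_degree:
  assumes "x \<in> pverts G" "y \<in> pverts H"
  shows "strong_subgraph_arc_connectivity 2 (with_proj (G \<box> H)) \<le>
    in_degree (with_proj G) x + in_degree (with_proj H) y"
proof -
  obtain q where q: "q \<in> pverts G \<times> pverts H" "q \<noteq> (x, y)"
    by (rule other_vertex)
  let ?A = "(\<lambda>(u, v). ((u, y), (v, y))) ` in_arcs (with_proj G) x"
  let ?B = "(\<lambda>(u, v). ((x, u), (x, v))) ` in_arcs (with_proj H) y"
  have fin: "finite (in_arcs (with_proj G) x)" "finite (in_arcs (with_proj H) y)"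
    by (simp_all add: in_arcs_def G.pair_finite_arcs H.pair_finite_arcs)
  \<comment> \<open>Taking the complement of \<open>(x, y)\<close> as the source side makes every
    cut arc enter \<open>(x, y)\<close>.\<close>
  have "strong_subgraph_arc_connectivity 2 (with_proj (G \<box> H)) \<le>
      card (out_cut (with_proj (G \<box> H)) (- {(x, y)}))"
    using assms q
    by (intro strong_subgraph_arc_connectivity_2_le_out_cut[OF fin_digraph_cartesian_product,
          of q "(x, y)"]) auto
  also have "\<dots> \<le> card (?A \<union> ?B)"
  proof (rule card_mono)
    show "finite (?A \<union> ?B)"
      using fin by simp
    show "out_cut (with_proj (G \<box> H)) (- {(x, y)}) \<subseteq> ?A \<union> ?B"
      by (force simp: out_cut_def in_arcs_def cartesian_product_def)
  qed
  also have "\<dots> \<le> card ?A + card ?B"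
    by (rule card_Un_le)
  also have "\<dots> \<le> in_degree (with_proj G) x + in_degree (with_proj H) y"
    unfolding in_degree_def by (intro add_mono card_image_le fin)
  finally show ?thesis .
qed

lemma product_connectivity_le_product_bound:
  "strong_subgraph_arc_connectivity 2 (with_proj (G \<box> H)) \<le> product_bound G H"
proof -
  \<comment> \<open>Each minimum degree is attained at some vertex, to which the vertexwise bounds
    apply.\<close>
  have "min_out_degree (with_proj G) \<in> out_degree (with_proj G) ` pverts G"
    "min_in_degree (with_proj G) \<in> in_degree (with_proj G) ` pverts G"
    "min_out_degree (with_proj H) \<in> out_degree (with_proj H) ` pverts H"
    "min_in_degree (with_proj H) \<in> in_degree (with_proj H) ` pverts H"
    unfolding min_out_degree_def min_in_degree_def with_proj_simps
    by (intro Min_in; use pverts_nonempty G.pair_finite_verts H.pair_finite_verts in simp)+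
  then show ?thesis
    using product_connectivity_le_out_degree product_connectivity_le_in_degree
      product_connectivity_le_arc_strong_left product_connectivity_le_arc_strong_right
    by (auto simp: product_bound_def)
qed

end

section \<open>Sharpness\<close>

definition complete_digraph_2 :: "nat pair_pre_digraph" where
  "complete_digraph_2 = \<lparr>pverts = {0, 1}, parcs = {(0, 1), (1, 0)}\<rparr>"

lemma pair_digraph_complete_digraph_2: "pair_digraph complete_digraph_2"
  by unfold_locales (auto simp: complete_digraph_2_def)

lemma strongly_connected_complete_digraph_2: "strongly_connected (with_proj complete_digraph_2)"
proof -
  interpret pair_digraph complete_digraph_2
    by (rule pair_digraph_complete_digraph_2)
  have "0 \<rightarrow>\<^sup>*\<^bsub>with_proj complete_digraph_2\<^esub> 1" "1 \<rightarrow>\<^sup>*\<^bsub>with_proj complete_digraph_2\<^esub> 0"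
    by (rule reachable_adjI; simp add: complete_digraph_2_def)+
  moreover have "pverts complete_digraph_2 = {0, 1}"
    by (simp add: complete_digraph_2_def)
  ultimately show ?thesis
    unfolding strongly_connected_def with_proj_simps
    by (metis empty_iff insertE insertI1 reachable_trans)
qed

lemma min_out_degree_complete_digraph_2: "min_out_degree (with_proj complete_digraph_2) = 1"
proof -
  have "out_arcs (with_proj complete_digraph_2) 0 = {(0, 1)}"
    "out_arcs (with_proj complete_digraph_2) 1 = {(1, 0)}"
    by (auto simp: out_arcs_def complete_digraph_2_def)
  then show ?thesis
    by (simp add: min_out_degree_def out_degree_def) (simp add: complete_digraph_2_def)
qed

lemma strongly_connected_4_cycle:
  assumes "V = {a, b, c, d}" "A = {(a, b), (b, c), (c, d), (d, a)}"
  shows "strongly_connected (with_proj \<lparr>pverts = V, parcs = A\<rparr>)"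
proof -
  let ?K = "\<lparr>pverts = V, parcs = A\<rparr>"
  interpret pair_wf_digraph ?K
    by unfold_locales (use assms in auto)
  have path: "a \<rightarrow>\<^sup>*\<^bsub>with_proj ?K\<^esub> b" "b \<rightarrow>\<^sup>*\<^bsub>with_proj ?K\<^esub> c"
    "c \<rightarrow>\<^sup>*\<^bsub>with_proj ?K\<^esub> d" "d \<rightarrow>\<^sup>*\<^bsub>with_proj ?K\<^esub> a"
    by (rule reachable_adjI; use assms in simp)+
  \<comment> \<open>Any two vertices are joined by routing through \<open>a\<close>.\<close>
  then have "x \<rightarrow>\<^sup>*\<^bsub>with_proj ?K\<^esub> a \<and> a \<rightarrow>\<^sup>*\<^bsub>with_proj ?K\<^esub> x" if "x \<in> {a, b, c, d}" for x
    using that by (elim insertE emptyE) (metis reachable_trans)+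
  then show ?thesis
    unfolding strongly_connected_def with_proj_simps pair_pre_digraph.select_convs
    using assms(1) by (metis insert_not_empty reachable_trans)
qed

text \<open>Both oriented 4-cycles span the product, so the same two subgraphs serve every
  \<open>S\<close>.\<close>

lemma product_connectivity_complete_digraph_2_ge:
  "2 \<le> strong_subgraph_arc_connectivity 2 (with_proj (complete_digraph_2 \<box> complete_digraph_2))"
proof (rule strong_subgraph_arc_connectivity_geI)
  let ?D = "with_proj (complete_digraph_2 \<box> complete_digraph_2)"
  interpret pair_digraph complete_digraph_2
    by (rule pair_digraph_complete_digraph_2)
  show fin: "fin_digraph ?D"
    by (intro pair_fin_digraph_imp_fin_digraph pair_fin_digraph_cartesian_product
        pair_fin_digraph_axioms)
  show "2 \<le> card (verts ?D)"
    by (simp add: complete_digraph_2_def card_cartesian_product)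
  let ?V = "{(0, 0), (1, 0), (1, 1), (0, 1)} :: (nat \<times> nat) set"
  \<comment> \<open>Consecutive vertices differ in exactly one coordinate, so each arc, and its
    reverse, is an arc of the product.\<close>
  let ?A = "{((0, 0), (1, 0)), ((1, 0), (1, 1)), ((1, 1), (0, 1)), ((0, 1), (0, 0))}
    :: (nat \<times> nat) rel"
  let ?K = "with_proj \<lparr>pverts = ?V, parcs = ?A\<rparr>" and ?L = "with_proj \<lparr>pverts = ?V, parcs = ?A\<inverse>\<rparr>"
  fix S assume S: "S \<subseteq> verts ?D" "card S = 2"
  have verts: "verts ?D = ?V"
    by (auto simp: complete_digraph_2_def)
  have "?A \<subseteq> arcs ?D" "?A\<inverse> \<subseteq> arcs ?D"
    by (auto simp: complete_digraph_2_def cartesian_product_def)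
  then have "subgraph ?K ?D" "subgraph ?L ?D"
    using verts fin
    by (auto simp: subgraph_def compatible_def wf_digraph_def fin_digraph_def)
  moreover have "strongly_connected ?K"
    by (rule strongly_connected_4_cycle) (rule refl)+
  moreover have "strongly_connected ?L"
    by (rule strongly_connected_4_cycle[of _ "(0, 0)" "(0, 1)" "(1, 1)" "(1, 0)"]) auto
  ultimately have "strong_subgraph_on S ?D ?K" "strong_subgraph_on S ?D ?L"
    using S(1) unfolding verts by (auto simp: strong_subgraph_on_def)
  moreover have disj: "arcs ?K \<inter> arcs ?L = {}"
    by auto
  ultimately have "card {?K, ?L} \<le> lambda_set S ?D"
    by (intro lambda_set_geI[OF fin]) (auto simp: pairwise_insert)
  \<comment> \<open>Families are sets, so distinctness is needed for the count 2; equal members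
    would have an empty arc set by disjointness.\<close>
  moreover have "?K \<noteq> ?L"
    using disj by (metis Int_absorb insert_not_empty with_proj_simps(2) pair_pre_digraph.select_convs(2))
  ultimately show "2 \<le> lambda_set S ?D"
    by simp
qed

theorem theorem4p1:
  shows "(\<forall>(G :: 'a pair_pre_digraph) (H :: 'b pair_pre_digraph).
      pair_digraph G \<and> pair_digraph H \<and>
      strongly_connected (with_proj G) \<and> strongly_connected (with_proj H) \<and>
      card (pverts G) \<ge> 2 \<and> card (pverts H) \<ge> 2 \<longrightarrow>
      strong_subgraph_arc_connectivity 2 (with_proj (G \<box> H)) \<le> product_bound G H) \<and>
    (\<exists>(G :: nat pair_pre_digraph) (H :: nat pair_pre_digraph).
      pair_digraph G \<and> pair_digraph H \<and>
      strongly_connected (with_proj G) \<and> strongly_connected (with_proj H) \<and>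
      card (pverts G) \<ge> 2 \<and> card (pverts H) \<ge> 2 \<and>
      strong_subgraph_arc_connectivity 2 (with_proj (G \<box> H)) = product_bound G H)"
proof (intro conjI exI)
  let ?G = complete_digraph_2
  show card: "card (pverts ?G) \<ge> 2" "card (pverts ?G) \<ge> 2"
    by (simp_all add: complete_digraph_2_def)
  \<comment> \<open>The out-degree sum, 1 + 1, already bounds the minimum; with the lower bound 2 on
    the connectivity this forces equality.\<close>
  have "product_bound ?G ?G \<le> 2"
    by (simp add: product_bound_def min_out_degree_complete_digraph_2)
  moreover have "strong_subgraph_arc_connectivity 2 (with_proj (?G \<box> ?G)) \<le> product_bound ?G ?G"
    using pair_digraph_complete_digraph_2 card
    by (intro product_connectivity_le_product_bound) (auto simp: pair_digraph_def)
  ultimately show "strong_subgraph_arc_connectivity 2 (with_proj (?G \<box> ?G)) = product_bound ?G ?G"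
    using product_connectivity_complete_digraph_2_ge by linarith
qed (auto simp: pair_digraph_def[of G for G :: "'a pair_pre_digraph"]
    pair_digraph_def[of H for H :: "'b pair_pre_digraph"] product_connectivity_le_product_bound
    pair_digraph_complete_digraph_2 strongly_connected_complete_digraph_2)

end
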